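(* Define $G_{2n}(q)$ for $n\ge1$ by \[ \sum_{n\ge1}G_{2n}(q)z^{n-1}=\cfrac{1}{1-\cfrac{\lambda_1z}{1-\cfrac{\lambda_2z}{1-\cdots}}},\qquad \lambda_{2m-1}=[m]_q^2,\quad \lambda_{2m}=[m]_q[m+1]_q\ (m\ge1). \] For integers $k\ge -1$ let $P_k=\sum_{i=0}^{k}(-1)^i(2i+1)q^{\binom{k+1}{2}-\binom{i+1}{2}}$ (so $P_{-1}=0$), and for $k\ge0$ let $Y_k=\dfrac{P_{k-1}+2P_k+P_{k+1}}{q-1}$. Then each $Y_k$ is a polynomial in $q$, and for every $n\ge0$, \[ G_{2n+2}(q)=\frac{1}{(1-q)^{2n}}\sum_{k=0}^{n}\left(\binom{2n}{n-k}-\binom{2n}{n-k-1}\right)Y_k. \]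
   Context: $[m]_q=(1-q^m)/(1-q)$. The continued fraction is a formal power series in $z$ (limit of its finite truncations). Binomial coefficients with negative lower index are $0$. *)

theory Defs
  imports "HOL-Computational_Algebra.Computational_Algebra"
begin

text \<open>
  The indeterminate \<open>q\<close> is the variable of \<open>int poly\<close>; rational functions of \<open>q\<close> live in
  the fraction field \<open>int poly fract\<close>.
\<close>

definition q :: "int poly fract" where
  "q = to_fract [:0, 1:]"

definition qint :: "nat \<Rightarrow> int poly fract" where
  "qint m = (1 - q ^ m) / (1 - q)"

text \<open>
  \<open>S_trunc c N j\<close> is the finite continued fraction in the power series variable that uses the
  \<open>N\<close> coefficients \<open>c j, \<dots>, c (j + N - 1)\<close>:
  \<open>1 / (1 - c j z / (1 - c (j+1) z / (\<dots> / (1 - c (j+N-1) z))))\<close>.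
\<close>

fun S_trunc :: "(nat \<Rightarrow> 'a::field) \<Rightarrow> nat \<Rightarrow> nat \<Rightarrow> 'a fps" where
  "S_trunc c 0 j = 1"
| "S_trunc c (Suc N) j = 1 / (1 - fps_const (c j) * fps_X * S_trunc c N (Suc j))"

definition S_fraction :: "(nat \<Rightarrow> 'a::field) \<Rightarrow> 'a fps" where
  "S_fraction c = lim (\<lambda>N. S_trunc c N 1)"

lemma S_trunc_nth_Suc:
  "n \<le> N \<Longrightarrow> fps_nth (S_trunc c (Suc N) j) n = fps_nth (S_trunc c N j) n"
proof (induction N arbitrary: n j)
  case 0
  then show ?case by (simp add: fps_divide_unit)
next
  case (Suc N)
  define A where "A = 1 - fps_const (c j) * fps_X * S_trunc c (Suc N) (Suc j)"
  define B where "B = 1 - fps_const (c j) * fps_X * S_trunc c N (Suc j)"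
  have A0: "fps_nth A 0 = 1" and B0: "fps_nth B 0 = 1"
    by (simp_all add: A_def B_def)
  have AB: "fps_nth A m = fps_nth B m" if "m \<le> Suc N" for m
  proof (cases m)
    case (Suc m')
    then show ?thesis
      using Suc.IH[of m' "Suc j"] that
      by (simp add: A_def B_def mult.assoc del: S_trunc.simps)
  qed (simp add: A0 B0)
  have inv: "fps_nth (inverse A) m = fps_nth (inverse B) m" if "m \<le> Suc N" for m
    using that
  proof (induction m rule: less_induct)
    case (less m)
    show ?case
    proof (cases m)
      case 0
      then show ?thesis by (simp add: A0 B0)
    next
      case (Suc m')
      have *: "fps_nth (inverse D) m = - (\<Sum>i=0..<m. fps_nth D (m - i) * fps_nth (inverse D) i)"
        if D0: "fps_nth D 0 = 1" for D :: "'a fps"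
      proof -
        have "0 = fps_nth (inverse D * D) m"
          using D0 Suc by (simp add: inverse_mult_eq_1)
        also have "\<dots> = (\<Sum>i=0..m. fps_nth (inverse D) i * fps_nth D (m - i))"
          by (simp add: fps_mult_nth)
        also have "{0..m} = insert m {0..<m}" by auto
        finally show ?thesis
          using D0 by (simp add: eq_neg_iff_add_eq_0 mult.commute)
      qed
      show ?thesis
        unfolding *[OF A0] *[OF B0]
        using less by (intro arg_cong[of _ _ uminus] sum.cong refl) (simp add: AB)
    qed
  qed
  have "S_trunc c (Suc (Suc N)) j = inverse A" "S_trunc c (Suc N) j = inverse B"
    using A0 B0 by (simp_all add: A_def B_def fps_divide_unit)
  then show ?case using inv[OF Suc.prems] by simp
qed

lemma S_fraction_LIMSEQ: "(\<lambda>N. S_trunc c N 1) \<longlonglongrightarrow> S_fraction c"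
proof -
  have "fps_nth (S_trunc c (n + d) 1) n = fps_nth (S_trunc c n 1) n" for n d
    by (induction d) (simp_all add: S_trunc_nth_Suc del: S_trunc.simps)
  then have stable: "fps_nth (S_trunc c N 1) n = fps_nth (S_trunc c n 1) n" if "n \<le> N" for n N
    using that by (metis le_add_diff_inverse)
  have "(\<lambda>N. S_trunc c N 1) \<longlonglongrightarrow> Abs_fps (\<lambda>n. fps_nth (S_trunc c n 1) n)"
  proof (rule tendsto_fpsI)
    show "\<forall>\<^sub>F N in sequentially. fps_nth (S_trunc c N 1) n
        = fps_nth (Abs_fps (\<lambda>n. fps_nth (S_trunc c n 1) n)) n" for n
      unfolding fps_nth_Abs_fps by (rule eventually_sequentiallyI[of n]) (rule stable)
  qed
  then have "convergent (\<lambda>N. S_trunc c N 1)" by (rule convergentI)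
  then show ?thesis by (simp add: S_fraction_def convergent_LIMSEQ_iff)
qed

text \<open>Only the values at indices \<open>j \<ge> 1\<close> matter.\<close>

definition lam :: "nat \<Rightarrow> int poly fract" where
  "lam j = (if odd j then qint ((j + 1) div 2) ^ 2
            else qint (j div 2) * qint (j div 2 + 1))"

lemma lam_odd: "m \<ge> 1 \<Longrightarrow> lam (2 * m - 1) = qint m ^ 2"
  by (simp add: lam_def)

lemma lam_even: "lam (2 * m) = qint m * qint (m + 1)"
  by (simp add: lam_def)

text \<open>\<open>G2 n\<close> is \<open>G\<^bsub>2n\<^esub>(q)\<close>, meaningful for \<open>n \<ge> 1\<close>.\<close>

definition G2 :: "nat \<Rightarrow> int poly fract" where
  "G2 n = fps_nth (S_fraction lam) (n - 1)"

lemma G2_generating_function: "Abs_fps (\<lambda>n. G2 (n + 1)) = S_fraction lam"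
  by (simp add: fps_eq_iff G2_def)

text \<open>
  Intended for \<open>k \<ge> -1\<close>. The exponent is a subtraction of natural numbers but never
  truncates, since \<open>i \<le> k\<close>.
\<close>

definition P :: "int \<Rightarrow> int poly" where
  "P k = (\<Sum>i = 0..<nat (k + 1).
     monom ((-1) ^ i * (2 * int i + 1)) ((nat (k + 1) choose 2) - ((i + 1) choose 2)))"

definition Y :: "nat \<Rightarrow> int poly fract" where
  "Y k = to_fract (P (int k - 1) + 2 * P (int k) + P (int k + 1)) / (q - 1)"

definition ibinom :: "nat \<Rightarrow> int \<Rightarrow> int" where
  "ibinom n k = (if k < 0 then 0 else int (n choose nat k))"

end

theory Submission
  imports Defs
begin

text \<open>
  After rescaling by \<open>(1 - q)\<^sup>2\<close> the coefficients of the fraction become \<open>(1 - q\<^sup>m)\<^sup>2\<close> and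
  \<open>(1 - q\<^sup>m)(1 - q\<^bsup>m+1\<^esup>)\<close>, and its even contraction is the continued fraction of the continuous
  dual \<open>q\<close>-Hahn polynomials \<open>r\<^sub>n(y)\<close>. A linear functional \<open>L\<close> with \<open>L r\<^sub>0 = 1\<close> and \<open>L r\<^sub>n = 0\<close> for
  \<open>n \<ge> 1\<close> therefore has the coefficients of the fraction as moments \<open>L y\<^sup>n\<close>.

  Take for \<open>L\<close> the functional whose moments are the ballot sums of the \<open>Y\<^sub>k\<close>. With
  \<open>y = 2 + w + 1/w\<close> this means that \<open>L\<close> maps \<open>\<Sum>\<^bsub>|i|\<le>k\<^esub> w\<^sup>i\<close> to \<open>Y\<^sub>k\<close>. The polynomials \<open>r\<^sub>n\<close> are
  triangularly related to
  \<open>\<psi>\<^sub>k(y) = \<Prod>\<^bsub>i=1..k\<^esub> ((1 - q\<^sup>i)\<^sup>2 + q\<^sup>i y) = \<Prod>\<^bsub>i=1..k\<^esub> (1 + q\<^sup>i w)(1 + q\<^sup>i / w)\<close>,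
  so it suffices that \<open>L \<psi>\<^sub>k = (q;q)\<^sub>k (q;q)\<^bsub>k+1\<^esub> / (1 - q)\<close>. By the finite Jacobi triple product,
  \<open>\<psi>\<^sub>k\<close> is a combination of the alternating sums \<open>\<tau>\<^sub>j = \<Sum>\<^bsub>|i|\<le>j\<^esub> (-1)\<^bsup>i+j\<^esup> w\<^sup>i\<close> with \<open>q\<close>-binomial
  coefficients, and comparing \<open>L \<tau>\<^sub>j\<close> with \<open>\<tau>\<^sub>j(0)\<close> leaves a telescoping sum:
  \<open>L \<psi>\<^sub>k = (1 - q\<^bsup>k+1\<^esup>) / (1 - q) \<cdot> \<psi>\<^sub>k(0)\<close>, where \<open>\<psi>\<^sub>k(0) = (q;q)\<^sub>k\<^sup>2\<close>.
\<close>

section \<open>Polynomials with a three-term recurrence\<close>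

fun orth_poly :: "(nat \<Rightarrow> 'a::comm_ring_1) \<Rightarrow> (nat \<Rightarrow> 'a) \<Rightarrow> nat \<Rightarrow> 'a poly" where
  "orth_poly \<beta> \<gamma> 0 = 1"
| "orth_poly \<beta> \<gamma> (Suc 0) = [:- \<beta> 0, 1:]"
| "orth_poly \<beta> \<gamma> (Suc (Suc n)) =
     [:- \<beta> (Suc n), 1:] * orth_poly \<beta> \<gamma> (Suc n) - smult (\<gamma> (Suc n)) (orth_poly \<beta> \<gamma> n)"

definition jacobi_op :: "(nat \<Rightarrow> 'a::comm_ring_1) \<Rightarrow> (nat \<Rightarrow> 'a) \<Rightarrow> (nat \<Rightarrow> 'a) \<Rightarrow> nat \<Rightarrow> 'a" where
  "jacobi_op \<beta> \<gamma> f n = (case n of 0 \<Rightarrow> 0 | Suc m \<Rightarrow> f m) + \<beta> n * f n + \<gamma> (Suc n) * f (Suc n)"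

lemma jacobi_op_0: "jacobi_op \<beta> \<gamma> f 0 = \<beta> 0 * f 0 + \<gamma> 1 * f 1"
  by (simp add: jacobi_op_def)

lemma jacobi_op_Suc:
  "jacobi_op \<beta> \<gamma> f (Suc n) = f n + \<beta> (Suc n) * f (Suc n) + \<gamma> (Suc (Suc n)) * f (Suc (Suc n))"
  by (simp add: jacobi_op_def)

lemma sum_jacobi_op_orth_poly:
  "(\<Sum>n\<le>N. smult (jacobi_op \<beta> \<gamma> f n) (orth_poly \<beta> \<gamma> n))
    = [:0, 1:] * (\<Sum>n\<le>N. smult (f n) (orth_poly \<beta> \<gamma> n))
      - smult (f N) (orth_poly \<beta> \<gamma> (Suc N)) + smult (\<gamma> (Suc N) * f (Suc N)) (orth_poly \<beta> \<gamma> N)"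
proof (induction N)
  case 0
  show ?case
    by (simp add: jacobi_op_0 mult.commute)
next
  case (Suc N)
  have "[:0, 1:] * orth_poly \<beta> \<gamma> (Suc N) = orth_poly \<beta> \<gamma> (Suc (Suc N))
      + smult (\<beta> (Suc N)) (orth_poly \<beta> \<gamma> (Suc N)) + smult (\<gamma> (Suc N)) (orth_poly \<beta> \<gamma> N)"
    by simp
  then show ?case
    unfolding sum.atMost_Suc Suc distrib_left mult_smult_right jacobi_op_Suc
    by (simp add: smult_add_left smult_add_right mult.commute del: orth_poly.simps mult_pCons_left)
qed

lemma X_times_orth_poly_sum:
  assumes "\<And>n. N < n \<Longrightarrow> f n = 0"
  shows "[:0, 1:] * (\<Sum>n\<le>N. smult (f n) (orth_poly \<beta> \<gamma> n))
    = (\<Sum>n\<le>Suc N. smult (jacobi_op \<beta> \<gamma> f n) (orth_poly \<beta> \<gamma> n))"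
  unfolding sum_jacobi_op_orth_poly[of \<beta> \<gamma> f "Suc N"] by (simp add: assms)

lemma smult_sum_right: "smult x (\<Sum>i\<in>I. f i) = (\<Sum>i\<in>I. smult x (f i))"
  by (induction I rule: infinite_finite_induct) (simp_all add: smult_add_right)

abbreviation linear_functional :: "('a::comm_ring_1 poly \<Rightarrow> 'a) \<Rightarrow> bool" where
  "linear_functional \<equiv> module_hom smult (*)"

locale connection_coeffs =
  fixes A B \<beta> \<gamma> :: "nat \<Rightarrow> 'a::idom" and C :: "nat \<Rightarrow> nat \<Rightarrow> 'a"
  assumes C_0: "C 0 n = of_bool (n = 0)"
    and C_Suc: "C (Suc k) n = A k * C k n + B k * jacobi_op \<beta> \<gamma> (C k) n"
begin

lemma C_eq_0: "k < n \<Longrightarrow> C k n = 0"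
proof (induction k arbitrary: n)
  case (Suc k)
  then show ?case
    by (cases n) (simp_all add: C_Suc jacobi_op_Suc)
qed (simp add: C_0)

lemma C_diag: "C k k = (\<Prod>i<k. B i)"
  by (induction k) (simp_all add: C_0 C_Suc jacobi_op_Suc C_eq_0)

lemma prod_linear_expansion: "(\<Prod>i<k. [:A i, B i:]) = (\<Sum>n\<le>k. smult (C k n) (orth_poly \<beta> \<gamma> n))"
proof (induction k)
  case (Suc k)
  let ?p = "orth_poly \<beta> \<gamma>" and ?S = "\<Prod>i<k. [:A i, B i:]"
  have "(\<Prod>i<Suc k. [:A i, B i:]) = smult (A k) ?S + smult (B k) ([:0, 1:] * ?S)"
    by (simp add: mult.commute)
  also have "?S = (\<Sum>n\<le>Suc k. smult (C k n) (?p n))"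
    by (simp add: Suc C_eq_0)
  also have "[:0, 1:] * \<dots> = (\<Sum>n\<le>Suc k. smult (jacobi_op \<beta> \<gamma> (C k) n) (?p n))"
    using X_times_orth_poly_sum[of k "C k" \<beta> \<gamma>] by (simp add: C_eq_0)
  also have "smult (A k) (\<Sum>n\<le>Suc k. smult (C k n) (?p n)) + smult (B k) \<dots>
      = (\<Sum>n\<le>Suc k. smult (C (Suc k) n) (?p n))"
    by (simp only: smult_sum_right smult_smult C_Suc smult_add_left sum.distrib)
  finally show ?case .
qed (simp add: C_0)

lemma functional_prod_linear:
  assumes "linear_functional L"
  shows "L (\<Prod>i<k. [:A i, B i:]) = (\<Sum>n\<le>k. C k n * L (orth_poly \<beta> \<gamma> n))"
  unfolding prod_linear_expansion module_hom.sum[OF assms] module_hom.scale[OF assms] ..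

lemma functional_orth_poly_eq:
  assumes L: "linear_functional L" and B: "\<And>i. B i \<noteq> 0"
    and y: "\<And>k. L (\<Prod>i<k. [:A i, B i:]) = (\<Sum>n\<le>k. C k n * y n)"
  shows "L (orth_poly \<beta> \<gamma> n) = y n"
proof (induction n rule: less_induct)
  case (less n)
  have "(\<Sum>m\<le>n. C n m * L (orth_poly \<beta> \<gamma> m)) = (\<Sum>m\<le>n. C n m * y m)"
    by (simp only: functional_prod_linear[OF L, symmetric] y)
  moreover have "(\<Sum>m<n. C n m * L (orth_poly \<beta> \<gamma> m)) = (\<Sum>m<n. C n m * y m)"
    using less by (intro sum.cong) simp_all
  ultimately have "C n n * L (orth_poly \<beta> \<gamma> n) = C n n * y n"
    by (simp add: lessThan_Suc_atMost[symmetric])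
  moreover have "C n n \<noteq> 0"
    using B by (simp add: C_diag)
  ultimately show ?case by simp
qed

end

definition moment_functional :: "(nat \<Rightarrow> 'a::comm_ring_1) \<Rightarrow> 'a poly \<Rightarrow> 'a" where
  "moment_functional \<mu> p = (\<Sum>i\<le>degree p. coeff p i * \<mu> i)"

lemma moment_functional_eq:
  assumes "degree p \<le> N"
  shows "moment_functional \<mu> p = (\<Sum>i\<le>N. coeff p i * \<mu> i)"
  unfolding moment_functional_def
  using assms by (intro sum.mono_neutral_left) (auto simp: coeff_eq_0)

lemma linear_functional_moment_functional: "linear_functional (moment_functional \<mu>)"
proof
  fix p r :: "'a poly" and x :: 'a
  define N where "N = max (degree p) (degree r)"
  have "degree p \<le> N" "degree r \<le> N" "degree (p + r) \<le> N"
    by (auto simp: N_def intro: degree_add_le)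
  then show "moment_functional \<mu> (p + r) = moment_functional \<mu> p + moment_functional \<mu> r"
    by (simp add: moment_functional_eq[of _ N] sum.distrib algebra_simps)
  show "moment_functional \<mu> (smult x p) = x * moment_functional \<mu> p"
    by (subst moment_functional_eq[of _ "degree p"])
      (simp_all add: degree_smult_le moment_functional_def sum_distrib_left mult.assoc)
qed (simp_all add: smult_add_left smult_add_right algebra_simps)

lemma moment_functional_power: "moment_functional \<mu> ([:0, 1:] ^ n) = \<mu> n"
proof -
  have "moment_functional \<mu> (monom 1 n) = (\<Sum>i\<le>n. coeff (monom 1 n) i * \<mu> i)"
    by (rule moment_functional_eq) (rule degree_monom_le)
  also have "\<dots> = (\<Sum>i\<le>n. if i = n then \<mu> i else 0)"
    by (intro sum.cong) auto
  also have "\<dots> = \<mu> n"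
    by simp
  finally show ?thesis by (simp add: monom_altdef)
qed

section \<open>Moments of a Stieltjes fraction\<close>

definition S_tail :: "(nat \<Rightarrow> 'a::field) \<Rightarrow> nat \<Rightarrow> 'a fps" where
  "S_tail c j = Abs_fps (\<lambda>n. fps_nth (S_trunc c n j) n)"

lemma S_trunc_nth_eq_S_tail:
  assumes "n \<le> N"
  shows "fps_nth (S_trunc c N j) n = fps_nth (S_tail c j) n"
  using assms
  by (induction rule: dec_induct) (simp_all add: S_tail_def S_trunc_nth_Suc del: S_trunc.simps)

lemma S_fraction_eq_S_tail: "S_fraction c = S_tail c 1"
proof -
  have "(\<lambda>N. S_trunc c N 1) \<longlonglongrightarrow> S_tail c 1"
    by (rule tendsto_fpsI)
      (auto intro!: eventually_sequentiallyI S_trunc_nth_eq_S_tail)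
  then show ?thesis
    using S_fraction_LIMSEQ LIMSEQ_unique by blast
qed

lemma S_trunc_Suc_eq:
  "S_trunc c (Suc N) j
    = 1 + fps_const (c j) * fps_X * (S_trunc c (Suc N) j * S_trunc c N (Suc j))"
proof -
  define D where "D = 1 - fps_const (c j) * fps_X * S_trunc c N (Suc j)"
  have "fps_nth D 0 = 1" by (simp add: D_def)
  then have "S_trunc c (Suc N) j * D = 1"
    by (simp add: D_def[symmetric] fps_divide_unit inverse_mult_eq_1)
  then show ?thesis
    by (simp add: D_def algebra_simps del: S_trunc.simps)
qed

lemma S_tail_nth_0: "fps_nth (S_tail c j) 0 = 1"
  by (simp add: S_tail_def)

lemma S_tail_nth_Suc:
  "fps_nth (S_tail c j) (Suc n) = c j * fps_nth (S_tail c j * S_tail c (Suc j)) n"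
proof -
  let ?T = "S_trunc c (Suc (Suc n)) j" and ?U = "S_trunc c (Suc n) (Suc j)"
  have "fps_nth (S_tail c j) (Suc n) = fps_nth ?T (Suc n)"
    by (rule S_trunc_nth_eq_S_tail[symmetric]) simp
  also have "\<dots> = c j * fps_nth (?T * ?U) n"
    by (subst S_trunc_Suc_eq) (simp add: mult.assoc del: S_trunc.simps)
  also have "fps_nth (?T * ?U) n = fps_nth (S_tail c j * S_tail c (Suc j)) n"
    unfolding fps_mult_nth
    by (intro sum.cong refl arg_cong2[where f = times] S_trunc_nth_eq_S_tail) auto
  finally show ?thesis .
qed

lemma S_tail_eq: "S_tail c j = 1 + fps_const (c j) * fps_X * (S_tail c j * S_tail c (Suc j))"
proof (rule fps_ext)
  show "fps_nth (S_tail c j) n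
      = fps_nth (1 + fps_const (c j) * fps_X * (S_tail c j * S_tail c (Suc j))) n" for n
    by (cases n) (simp_all add: S_tail_nth_0 S_tail_nth_Suc mult.assoc)
qed

lemma S_tail_scale: "fps_nth (S_tail (\<lambda>i. a * c i) j) n = a ^ n * fps_nth (S_tail c j) n"
proof (induction n arbitrary: j rule: less_induct)
  case (less n)
  show ?case
  proof (cases n)
    case (Suc m)
    have "fps_nth (S_tail (\<lambda>i. a * c i) j * S_tail (\<lambda>i. a * c i) (Suc j)) m
        = (\<Sum>i=0..m. a ^ i * fps_nth (S_tail c j) i
            * (a ^ (m - i) * fps_nth (S_tail c (Suc j)) (m - i)))"
      unfolding fps_mult_nth using less Suc by (intro sum.cong) simp_all
    also have "\<dots> = a ^ m * fps_nth (S_tail c j * S_tail c (Suc j)) m"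
      unfolding fps_mult_nth sum_distrib_left
      by (intro sum.cong) (simp_all add: mult_ac flip: power_add)
    finally show ?thesis
      by (simp add: Suc S_tail_nth_Suc)
  qed (simp add: S_tail_nth_0)
qed

lemma S_fraction_scale: "fps_nth (S_fraction (\<lambda>i. a * c i)) n = a ^ n * fps_nth (S_fraction c) n"
  by (simp add: S_fraction_eq_S_tail S_tail_scale)

lemma prod_S_tail_Suc:
  "(\<Prod>i=1..Suc m. S_tail c i)
    = (\<Prod>i=1..m. S_tail c i) + fps_const (c (Suc m)) * fps_X * (\<Prod>i=1..Suc (Suc m). S_tail c i)"
proof -
  have "(\<Prod>i=1..Suc m. S_tail c i) = (\<Prod>i=1..m. S_tail c i)
      * (1 + fps_const (c (Suc m)) * fps_X * (S_tail c (Suc m) * S_tail c (Suc (Suc m))))"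
    by (simp flip: S_tail_eq)
  also have "\<dots> = (\<Prod>i=1..m. S_tail c i)
      + fps_const (c (Suc m)) * fps_X * (\<Prod>i=1..Suc (Suc m). S_tail c i)"
    by (simp add: algebra_simps)
  finally show ?thesis .
qed

lemma prod_S_tail_Suc_Suc:
  "(\<Prod>i=1..Suc (Suc m). S_tail c i) = (\<Prod>i=1..m. S_tail c i)
    + fps_const (c (Suc m) + c (Suc (Suc m))) * fps_X * (\<Prod>i=1..Suc (Suc m). S_tail c i)
    + fps_const (c (Suc (Suc m)) * c (Suc (Suc (Suc m)))) * fps_X\<^sup>2
      * (\<Prod>i=1..Suc (Suc (Suc (Suc m))). S_tail c i)"
proof -
  define T where "T m = (\<Prod>i=1..m. S_tail c i)" for m
  have T: "T (Suc i) = T i + fps_const (c (Suc i)) * fps_X * T (Suc (Suc i))" for i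
    unfolding T_def by (rule prod_S_tail_Suc)
  have "T (Suc (Suc m)) = T m + fps_const (c (Suc m)) * fps_X * T (Suc (Suc m))
      + fps_const (c (Suc (Suc m))) * fps_X * T (Suc (Suc (Suc m)))"
    using T[of m] T[of "Suc m"] by (simp only:)
  also have "T (Suc (Suc (Suc m))) = T (Suc (Suc m))
      + fps_const (c (Suc (Suc (Suc m)))) * fps_X * T (Suc (Suc (Suc (Suc m))))"
    by (rule T)
  also have "T m + fps_const (c (Suc m)) * fps_X * T (Suc (Suc m))
      + fps_const (c (Suc (Suc m))) * fps_X * \<dots>
      = T m + fps_const (c (Suc m) + c (Suc (Suc m))) * fps_X * T (Suc (Suc m))
      + fps_const (c (Suc (Suc m)) * c (Suc (Suc (Suc m)))) * fps_X\<^sup>2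
        * T (Suc (Suc (Suc (Suc m))))"
    by (simp add: algebra_simps power2_eq_square flip: fps_const_add fps_const_mult)
  finally show ?thesis
    unfolding T_def .
qed

text \<open>
  Recurrence coefficients of the even contraction. The entry \<open>c 0\<close> does not occur in the fraction;
  the formula for \<open>contraction_diag c 0\<close> is the right one when \<open>c 0 = 0\<close>.
\<close>

definition contraction_diag :: "(nat \<Rightarrow> 'a::comm_ring_1) \<Rightarrow> nat \<Rightarrow> 'a" where
  "contraction_diag c h = c (2 * h) + c (2 * h + 1)"

definition contraction_offdiag :: "(nat \<Rightarrow> 'a::comm_ring_1) \<Rightarrow> nat \<Rightarrow> 'a" where
  "contraction_offdiag c h = c (2 * h - 1) * c (2 * h)"

text \<open>
  Coefficient \<open>n\<close> of \<open>even_path_gf c h\<close> is the weighted number of nonnegative lattice paths with \<open>2 n\<close>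
  steps from height \<open>0\<close> to height \<open>2 h\<close>, a down-step from height \<open>i\<close> having weight \<open>c i\<close>.
\<close>

definition even_path_gf :: "(nat \<Rightarrow> 'a::field) \<Rightarrow> nat \<Rightarrow> 'a fps" where
  "even_path_gf c h = fps_X ^ h * (\<Prod>i=1..2 * h + 1. S_tail c i)"

lemma even_path_gf_0:
  assumes "c 0 = 0"
  shows "even_path_gf c 0 = 1 + fps_X * (fps_const (contraction_diag c 0) * even_path_gf c 0
    + fps_const (contraction_offdiag c 1) * even_path_gf c 1)"
proof -
  define T where "T m = (\<Prod>i=1..m. S_tail c i)" for m
  have "T 1 = 1 + fps_const (c 1) * fps_X * T 2"
    using prod_S_tail_Suc[of c 0] by (simp add: T_def numeral_2_eq_2)
  also have "T 2 = T 1 + fps_const (c 2) * fps_X * T 3"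
    using prod_S_tail_Suc[of c 1] unfolding T_def eval_nat_numeral by simp
  finally have "T 1 = 1 + fps_X * (fps_const (c 1) * T 1 + fps_const (c 1 * c 2) * (fps_X * T 3))"
    by (simp add: algebra_simps flip: fps_const_mult)
  moreover have "even_path_gf c 0 = T 1" "even_path_gf c 1 = fps_X * T 3"
    by (simp_all add: even_path_gf_def T_def)
  ultimately show ?thesis
    using assms by (simp add: contraction_diag_def contraction_offdiag_def)
qed

lemma even_path_gf_Suc:
  "even_path_gf c (Suc h) = fps_X * (even_path_gf c h
    + fps_const (contraction_diag c (Suc h)) * even_path_gf c (Suc h)
    + fps_const (contraction_offdiag c (Suc (Suc h))) * even_path_gf c (Suc (Suc h)))"
proof -
  define T where "T m = (\<Prod>i=1..m. S_tail c i)" for m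
  have gf: "even_path_gf c h = fps_X ^ h * T (2 * h + 1)" for h
    by (simp add: even_path_gf_def T_def)
  have "T (2 * Suc h + 1) = T (2 * h + 1)
      + fps_const (contraction_diag c (Suc h)) * fps_X * T (2 * Suc h + 1)
      + fps_const (contraction_offdiag c (Suc (Suc h))) * fps_X\<^sup>2 * T (2 * Suc (Suc h) + 1)"
    using prod_S_tail_Suc_Suc[of c "2 * h + 1"]
    by (simp add: T_def contraction_diag_def contraction_offdiag_def)
  then have "even_path_gf c (Suc h) = fps_X ^ Suc h * (T (2 * h + 1)
      + fps_const (contraction_diag c (Suc h)) * fps_X * T (2 * Suc h + 1)
      + fps_const (contraction_offdiag c (Suc (Suc h))) * fps_X\<^sup>2 * T (2 * Suc (Suc h) + 1))"
    unfolding gf by (rule arg_cong)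
  also have "\<dots> = fps_X * (even_path_gf c h
      + fps_const (contraction_diag c (Suc h)) * even_path_gf c (Suc h)
      + fps_const (contraction_offdiag c (Suc (Suc h))) * even_path_gf c (Suc (Suc h)))"
    unfolding gf by (simp only: distrib_left power_Suc power2_eq_square mult_ac)
  finally show ?thesis .
qed

lemma connection_coeffs_even_path_gf:
  assumes "c 0 = 0"
  shows "connection_coeffs (\<lambda>_. 0) (\<lambda>_. 1) (contraction_diag c) (contraction_offdiag c)
    (\<lambda>n h. fps_nth (even_path_gf c h) n)"
proof
  fix n h
  show "fps_nth (even_path_gf c n) 0 = of_bool (n = 0)"
    by (cases n) (simp_all add: even_path_gf_def S_tail_nth_0)
  show "fps_nth (even_path_gf c h) (Suc n) = 0 * fps_nth (even_path_gf c h) n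
      + 1 * jacobi_op (contraction_diag c) (contraction_offdiag c)
          (\<lambda>h. fps_nth (even_path_gf c h) n) h"
  proof (cases h)
    case 0
    show ?thesis
      unfolding 0 by (subst even_path_gf_0) (simp_all add: assms jacobi_op_0)
  next
    case (Suc m)
    show ?thesis
      unfolding Suc by (subst even_path_gf_Suc) (simp add: jacobi_op_Suc)
  qed
qed

lemma moments_eq_S_fraction:
  fixes L :: "'a::field poly \<Rightarrow> 'a"
  assumes L: "linear_functional L" and "c 0 = 0"
    and orth: "\<And>n. L (orth_poly (contraction_diag c) (contraction_offdiag c) n) = of_bool (n = 0)"
  shows "L ([:0, 1:] ^ n) = fps_nth (S_fraction c) n"
proof -
  interpret connection_coeffs "\<lambda>_. 0" "\<lambda>_. 1" "contraction_diag c" "contraction_offdiag c"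
    "\<lambda>n h. fps_nth (even_path_gf c h) n"
    by (rule connection_coeffs_even_path_gf) fact
  have "L ([:0, 1:] ^ n) = (\<Sum>h\<le>n. fps_nth (even_path_gf c h) n * of_bool (h = 0))"
    using functional_prod_linear[OF L, of n] by (simp add: orth)
  also have "\<dots> = fps_nth (even_path_gf c 0) n"
    by (simp add: of_bool_def if_distrib[of "times _"] cong: if_cong)
  also have "even_path_gf c 0 = S_fraction c"
    by (simp add: even_path_gf_def S_fraction_eq_S_tail)
  finally show ?thesis .
qed

section \<open>Chebyshev bases and ballot numbers\<close>

text \<open>
  With \<open>y = 2 + w + 1/w\<close>, \<open>cheb 1 k\<close> is \<open>\<Sum>\<^bsub>|i|\<le>k\<^esub> w\<^sup>i\<close> and \<open>cheb 3 k\<close> is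
  \<open>\<Sum>\<^bsub>|i|\<le>k\<^esub> (-1)\<^bsup>i+k\<^esup> w\<^sup>i\<close>.
\<close>

abbreviation cheb_diag :: "'a::comm_ring_1 \<Rightarrow> nat \<Rightarrow> 'a" where
  "cheb_diag a n \<equiv> (if n = 0 then a else 2)"

abbreviation cheb :: "'a::comm_ring_1 \<Rightarrow> nat \<Rightarrow> 'a poly" where
  "cheb a \<equiv> orth_poly (cheb_diag a) (\<lambda>_. 1)"

lemma cheb_3_add: "cheb 3 (Suc j) + cheb 3 j = cheb 1 (Suc j) - cheb 1 j"
proof (induction j rule: induct_nat_012)
  case (ge2 n)
  have rec: "cheb a (Suc (Suc i)) = [:-2, 1:] * cheb a (Suc i) - cheb a i" for a :: 'a and i
    by simp
  have "cheb 3 (Suc (Suc (Suc n))) + cheb 3 (Suc (Suc n))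
      = ([:-2, 1:] * cheb 3 (Suc (Suc n)) - cheb 3 (Suc n))
        + ([:-2, 1:] * cheb 3 (Suc n) - cheb 3 n :: 'a poly)"
    by (rule arg_cong2[where f = plus, OF rec rec])
  also have "\<dots> = [:-2, 1:] * (cheb 3 (Suc (Suc n)) + cheb 3 (Suc n)) - (cheb 3 (Suc n) + cheb 3 n)"
    by (simp only: algebra_simps)
  also have "\<dots> = [:-2, 1:] * (cheb 1 (Suc (Suc n)) - cheb 1 (Suc n)) - (cheb 1 (Suc n) - cheb 1 n)"
    by (simp only: ge2)
  also have "\<dots> = ([:-2, 1:] * cheb 1 (Suc (Suc n)) - cheb 1 (Suc n))
      - ([:-2, 1:] * cheb 1 (Suc n) - cheb 1 n)"
    by (simp only: algebra_simps)
  also have "\<dots> = cheb 1 (Suc (Suc (Suc n))) - cheb 1 (Suc (Suc n))"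
    by (rule arg_cong2[where f = minus, OF rec[symmetric] rec[symmetric]])
  finally show ?case .
qed (simp_all add: numeral_poly)

lemma poly_cheb_3_0: "poly (cheb 3 j) 0 = (-1) ^ j * (2 * of_nat j + 1)"
proof (induction j rule: induct_nat_012)
  case (ge2 n)
  have "poly (cheb 3 (Suc (Suc n))) 0 = - 2 * poly (cheb 3 (Suc n)) 0 - (poly (cheb 3 n) 0 :: 'a)"
    by simp
  then show ?case
    unfolding ge2 by (simp add: algebra_simps)
qed simp_all

lemma ibinom_Suc: "ibinom (Suc n) k = ibinom n k + ibinom n (k - 1)"
proof (cases "k \<le> 0")
  case False
  then obtain m where "k = int (Suc m)"
    by (metis gr0_conv_Suc not_le_imp_less zero_less_imp_eq_int)
  then show ?thesis by (simp add: ibinom_def nat_add_distrib)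
qed (auto simp: ibinom_def)

definition ballot :: "nat \<Rightarrow> nat \<Rightarrow> int" where
  "ballot n k = ibinom (2 * n) (int n - int k) - ibinom (2 * n) (int n - int k - 1)"

lemma ballot_Suc_Suc:
  "ballot (Suc n) (Suc k) = ballot n k + 2 * ballot n (Suc k) + ballot n (Suc (Suc k))"
  by (simp add: ballot_def ibinom_Suc algebra_simps)

lemma ballot_Suc_0: "ballot (Suc n) 0 = ballot n 0 + ballot n 1"
proof -
  have "ibinom (2 * n) (int n - 1) = ibinom (2 * n) (int n + 1)"
  proof (cases n)
    case (Suc m)
    have "Suc (Suc (2 * m)) choose m = Suc (Suc (2 * m)) choose (Suc (Suc m))"
      by (subst binomial_symmetric) auto
    with Suc show ?thesis
      by (simp add: ibinom_def nat_add_distrib del: binomial_Suc_Suc)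
  qed (simp add: ibinom_def)
  then show ?thesis
    by (simp add: ballot_def ibinom_Suc algebra_simps)
qed

lemma connection_coeffs_ballot:
  "connection_coeffs (\<lambda>_. 0) (\<lambda>_. 1) (cheb_diag 1) (\<lambda>_. 1) (\<lambda>n k. of_int (ballot n k) :: 'a::idom)"
proof
  fix n k
  show "(of_int (ballot 0 k) :: 'a) = of_bool (k = 0)"
    by (simp add: ballot_def ibinom_def)
  show "(of_int (ballot (Suc n) k) :: 'a) = 0 * of_int (ballot n k)
      + 1 * jacobi_op (cheb_diag 1) (\<lambda>_. 1) (\<lambda>k. of_int (ballot n k)) k"
    by (cases k) (simp_all add: jacobi_op_0 jacobi_op_Suc ballot_Suc_0 ballot_Suc_Suc)
qed

section \<open>The \<open>q\<close>-binomial coefficients\<close>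

lemma Suc_choose_two: "Suc n choose 2 = (n choose 2) + n"
  by (simp add: numeral_2_eq_2)

fun qbinom :: "'a::comm_ring_1 \<Rightarrow> nat \<Rightarrow> nat \<Rightarrow> 'a" where
  "qbinom u n 0 = 1"
| "qbinom u 0 (Suc k) = 0"
| "qbinom u (Suc n) (Suc k) = qbinom u n k + u ^ Suc k * qbinom u n (Suc k)"

lemma qbinom_absorb:
  "(1 - u ^ Suc k) * qbinom u (Suc n) (Suc k) = (1 - u ^ Suc n) * qbinom u n k"
proof (induction n arbitrary: k)
  case 0
  show ?case by (cases k) simp_all
next
  case (Suc n)
  show ?case
  proof (cases k)
    case 0
    then show ?thesis
      using arg_cong[OF Suc.IH[of 0], of "times u"] by (simp add: algebra_simps)
  next
    case (Suc j)
    let ?a = "qbinom u (Suc n) (Suc j)" and ?x = "u ^ Suc j" and ?y = "u ^ Suc n"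
    have "(1 - u * ?x) * qbinom u (Suc (Suc n)) (Suc (Suc j))
        = (1 - u * ?x) * ?a + u * ?x * ((1 - u * ?x) * qbinom u (Suc n) (Suc (Suc j)))"
      unfolding qbinom.simps(3)[of u "Suc n"] power_Suc[of u "Suc j"] by (simp only: algebra_simps)
    also have "(1 - u * ?x) * qbinom u (Suc n) (Suc (Suc j)) = (1 - ?y) * qbinom u n (Suc j)"
      using Suc.IH[of "Suc j"] by (simp only: power_Suc)
    also have "u * ?x * ((1 - ?y) * qbinom u n (Suc j)) = u * (1 - ?y) * (?a - qbinom u n j)"
      by (simp add: algebra_simps)
    also have "\<dots> = u * ((1 - ?y) * ?a - (1 - ?x) * ?a)"
      unfolding Suc.IH[of j] by (simp only: algebra_simps)
    also have "(1 - u * ?x) * ?a + u * ((1 - ?y) * ?a - (1 - ?x) * ?a) = (1 - u * ?y) * ?a"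
      by (simp only: algebra_simps)
    finally show ?thesis
      by (simp only: Suc power_Suc)
  qed
qed

lemma qbinom_Suc_right:
  "u ^ Suc k * (1 - u ^ Suc k) * qbinom u n (Suc k) = (u ^ Suc k - u ^ Suc n) * qbinom u n k"
  using qbinom_absorb[of u k n] by (simp add: algebra_simps)

lemma qbinom_Suc_Suc_Suc_Suc:
  "qbinom u (Suc (Suc n)) (Suc (Suc m)) = qbinom u n m
    + (1 + u) * u ^ Suc m * qbinom u n (Suc m) + (u ^ Suc (Suc m))\<^sup>2 * qbinom u n (Suc (Suc m))"
  by (simp add: algebra_simps power2_eq_square)

definition qpoch :: "'a::comm_ring_1 \<Rightarrow> nat \<Rightarrow> 'a" where
  "qpoch u n = (\<Prod>i<n. 1 - u ^ Suc i)"

lemma qpoch_Suc: "qpoch u (Suc n) = qpoch u n * (1 - u ^ Suc n)"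
  by (simp add: qpoch_def)

locale non_root_of_unity =
  fixes u :: "'a::field"
  assumes u_nonzero: "u \<noteq> 0"
    and u_power_neq_1: "m > 0 \<Longrightarrow> u ^ m \<noteq> 1"
begin

lemma one_minus_u_nonzero: "1 - u \<noteq> 0"
  using u_power_neq_1[of 1] by simp

lemma one_minus_power_nonzero: "1 - u ^ Suc m \<noteq> 0"
  using u_power_neq_1[of "Suc m"] by simp

lemma qpoch_nonzero: "qpoch u n \<noteq> 0"
  unfolding qpoch_def by (simp only: prod_zero_iff finite_lessThan one_minus_power_nonzero) blast

lemma qbinom_middle: "qbinom u (Suc (2 * k)) (Suc k) = qbinom u (Suc (2 * k)) k"
proof -
  have "u ^ Suc (Suc (2 * k)) = u ^ Suc k * u ^ Suc k"
    by (simp add: mult_2 flip: power_add)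
  then have "u ^ Suc k * (1 - u ^ Suc k) * qbinom u (Suc (2 * k)) (Suc k)
      = u ^ Suc k * (1 - u ^ Suc k) * qbinom u (Suc (2 * k)) k"
    unfolding qbinom_Suc_right by (simp only: right_diff_distrib mult_1_right)
  then show ?thesis
    using u_nonzero one_minus_power_nonzero[of k]
    by (simp del: power_Suc qbinom.simps)
qed

definition psi :: "nat \<Rightarrow> 'a poly" where
  "psi k = (\<Prod>i<k. [:(1 - u ^ Suc i)\<^sup>2, u ^ Suc i:])"

lemma poly_psi_0: "poly (psi k) 0 = (qpoch u k)\<^sup>2"
  by (simp add: psi_def qpoch_def poly_prod prod_power_distrib)

subsection \<open>Finite triple product\<close>

text \<open>
  For \<open>i \<ge> 1\<close>, \<open>triple_coeff k (i - 1)\<close> is the coefficient of both \<open>w\<^sup>i\<close> and \<open>w\<^bsup>1-i\<^esup>\<close> in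
  \<open>(1 + w) \<Prod>\<^bsub>m=1..k\<^esub> (1 + u\<^sup>m w)(1 + u\<^sup>m / w)\<close>.
\<close>

definition triple_coeff :: "nat \<Rightarrow> nat \<Rightarrow> 'a" where
  "triple_coeff k j = u ^ (Suc j choose 2) * qbinom u (Suc (2 * k)) (Suc (k + j))"

lemma triple_coeff_Suc_right:
  "(1 - u ^ Suc k * u ^ Suc j) * triple_coeff k (Suc j)
    = (u ^ Suc j - u ^ Suc k) * triple_coeff k j"
proof -
  define v where "v = u ^ Suc k"
  have powers: "u ^ Suc (Suc (k + j)) = v * u ^ Suc j" "u ^ Suc (Suc (2 * k)) = v * v"
    by (simp_all add: v_def mult_2 flip: power_add)
  have "v * u ^ Suc j * (1 - v * u ^ Suc j) * qbinom u (Suc (2 * k)) (Suc (Suc (k + j)))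
      = (v * u ^ Suc j - v * v) * qbinom u (Suc (2 * k)) (Suc (k + j))"
    using qbinom_Suc_right[of u "Suc (k + j)" "Suc (2 * k)"] unfolding powers .
  then have "v * (u ^ Suc j * (1 - v * u ^ Suc j) * qbinom u (Suc (2 * k)) (Suc (Suc (k + j))))
      = v * ((u ^ Suc j - v) * qbinom u (Suc (2 * k)) (Suc (k + j)))"
    by (simp only: algebra_simps)
  moreover have "v \<noteq> 0"
    using u_nonzero by (simp add: v_def)
  ultimately have "u ^ Suc j * (1 - v * u ^ Suc j) * qbinom u (Suc (2 * k)) (Suc (Suc (k + j)))
      = (u ^ Suc j - v) * qbinom u (Suc (2 * k)) (Suc (k + j))"
    by (simp only: mult_cancel_left simp_thms)
  from arg_cong[OF this, of "times (u ^ (Suc j choose 2))"] show ?thesis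
    unfolding triple_coeff_def v_def[symmetric] Suc_choose_two[of "Suc j"] power_add
      add_Suc_right[of k j]
    by (simp only: mult_ac)
qed

lemma triple_coeff_Suc_0:
  "triple_coeff (Suc k) 0
    = (1 + (u ^ Suc k)\<^sup>2) * triple_coeff k 0 + u ^ Suc k * (triple_coeff k 0 + triple_coeff k 1)"
proof -
  define v where "v = u ^ Suc k"
  have choose: "Suc 0 choose 2 = 0" "Suc (Suc 0) choose 2 = 1"
    by (simp_all add: Suc_choose_two binomial_eq_0)
  have index: "Suc (2 * Suc k) = Suc (Suc (Suc (2 * k)))"
    by simp
  have pascal: "triple_coeff (Suc k) 0 = triple_coeff k 0 + (1 + u) * v * triple_coeff k 0
      + u * v\<^sup>2 * triple_coeff k 1"
    unfolding triple_coeff_def choose index qbinom_Suc_Suc_Suc_Suc add_0_right add_Suc_right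
      One_nat_def qbinom_middle v_def
    by (simp add: power2_eq_square mult_ac del: qbinom.simps)
  have "(1 - u * v) * triple_coeff k 1 = (u - v) * triple_coeff k 0"
    using triple_coeff_Suc_right[of k 0] by (simp add: v_def mult_ac)
  then show ?thesis
    unfolding pascal v_def[symmetric] by algebra
qed

lemma triple_coeff_Suc_Suc:
  "triple_coeff (Suc k) (Suc j) = (1 + (u ^ Suc k)\<^sup>2) * triple_coeff k (Suc j)
    + u ^ Suc k * (triple_coeff k j + triple_coeff k (Suc (Suc j)))"
proof -
  define v where "v = u ^ Suc k"
  define x where "x = u ^ Suc j"
  have powers: "u ^ Suc (Suc (k + j)) = v * x" "u ^ Suc (Suc (Suc (k + j))) = u * v * x"
    "u ^ Suc (Suc j) = u * x"
    by (simp_all add: v_def x_def power_add mult_ac)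
  have choose: "u ^ (Suc (Suc j) choose 2) = u ^ (Suc j choose 2) * x"
    "u ^ (Suc (Suc (Suc j)) choose 2) = u ^ (Suc j choose 2) * x * (u * x)"
    unfolding Suc_choose_two[of "Suc (Suc j)"] Suc_choose_two[of "Suc j"] power_add powers x_def
    by simp_all
  have pascal: "triple_coeff (Suc k) (Suc j) = x * triple_coeff k j
      + (1 + u) * (v * x) * triple_coeff k (Suc j) + v\<^sup>2 * (u * x) * triple_coeff k (Suc (Suc j))"
    using qbinom_Suc_Suc_Suc_Suc[of u "Suc (2 * k)" "Suc (k + j)"] unfolding powers
    by (simp add: triple_coeff_def choose algebra_simps power2_eq_square
        del: qbinom.simps power_Suc)
  show ?thesis
    unfolding pascal
    using triple_coeff_Suc_right[of k j] triple_coeff_Suc_right[of k "Suc j"]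
    unfolding powers v_def[symmetric] x_def[symmetric] by algebra
qed

lemma connection_coeffs_triple_coeff:
  "connection_coeffs (\<lambda>i. (1 - u ^ Suc i)\<^sup>2) (\<lambda>i. u ^ Suc i) (cheb_diag 3) (\<lambda>_. 1) triple_coeff"
proof
  fix k n
  show "triple_coeff 0 n = of_bool (n = 0)"
    by (cases n) (simp_all add: triple_coeff_def binomial_eq_0)
  define v where "v = u ^ Suc k"
  show "triple_coeff (Suc k) n = (1 - u ^ Suc k)\<^sup>2 * triple_coeff k n
      + u ^ Suc k * jacobi_op (cheb_diag 3) (\<lambda>_. 1) (triple_coeff k) n"
    by (cases n; simp only: triple_coeff_Suc_0 triple_coeff_Suc_Suc jacobi_op_0 jacobi_op_Suc
        flip: v_def) (simp_all add: algebra_simps power2_eq_square)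
qed

lemma triple_coeff_alternating_sum:
  "(\<Sum>j\<le>k. triple_coeff k j * ((-1) ^ j * (2 * of_nat j + 1))) = (qpoch u k)\<^sup>2"
proof -
  have "(\<Sum>j\<le>k. triple_coeff k j * ((-1) ^ j * (2 * of_nat j + 1))) = poly (psi k) 0"
    unfolding psi_def connection_coeffs.prod_linear_expansion[OF connection_coeffs_triple_coeff]
    by (simp add: poly_sum poly_cheb_3_0)
  then show ?thesis
    by (simp only: poly_psi_0)
qed

text \<open>The index is shifted: \<open>P_seq k\<close> is the value of \<open>P\<^bsub>k-1\<^esub>\<close> at \<open>u\<close>.\<close>

primrec P_seq :: "nat \<Rightarrow> 'a" where
  "P_seq 0 = 0"
| "P_seq (Suc j) = u ^ j * P_seq j + (-1) ^ j * (2 * of_nat j + 1)"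

definition Y_seq :: "nat \<Rightarrow> 'a" where
  "Y_seq k = (P_seq k + 2 * P_seq (Suc k) + P_seq (Suc (Suc k))) / (u - 1)"

lemma triple_coeff_P_seq_sum:
  "(\<Sum>j\<le>k. triple_coeff k j * (P_seq (Suc (Suc j)) - P_seq j + 2 * (-1) ^ j))
    = - (qpoch u k * qpoch u (Suc k))"
proof -
  define v where "v = u ^ Suc k"
  define V where "V j = (1 - v * u ^ j) * P_seq j * triple_coeff k j" for j
  have "triple_coeff k j * (P_seq (Suc (Suc j)) - P_seq j + 2 * (-1) ^ j)
      = (V (Suc j) - V j) - (1 - v) * (triple_coeff k j * ((-1) ^ j * (2 * of_nat j + 1)))" for j
  proof -
    have "V (Suc j) = (u ^ Suc j - v) * P_seq (Suc j) * triple_coeff k j"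
      using triple_coeff_Suc_right[of k j] unfolding V_def v_def by (simp only: mult_ac)
    then show ?thesis
      unfolding V_def by (simp add: algebra_simps)
  qed
  then have "(\<Sum>j\<le>k. triple_coeff k j * (P_seq (Suc (Suc j)) - P_seq j + 2 * (-1) ^ j))
      = (\<Sum>j\<le>k. V (Suc j) - V j) - (1 - v) * (qpoch u k)\<^sup>2"
    by (simp only: sum_subtractf[of "\<lambda>j. V (Suc j) - V j"] triple_coeff_alternating_sum
        flip: sum_distrib_left)
  also have "(\<Sum>j\<le>k. V (Suc j) - V j) = V (Suc k) - V 0"
    using sum_lessThan_telescope[of V "Suc k"] by (simp only: lessThan_Suc_atMost)
  also have "V (Suc k) = 0"
    using triple_coeff_Suc_right[of k k] by (simp add: V_def v_def mult_ac del: P_seq.simps)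
  also have "V 0 = 0"
    by (simp add: V_def)
  finally show ?thesis
    by (simp add: qpoch_Suc v_def power2_eq_square mult_ac)
qed

lemma functional_cheb_3:
  assumes L: "linear_functional L"
    and cheb_1: "\<And>k. L (cheb 1 k) = Y_seq k"
  shows "L (cheb 3 j) = (P_seq (Suc (Suc j)) - P_seq j + 2 * (-1) ^ j) / (u - 1)"
proof (induction j)
  case 0
  show ?case using cheb_1[of 0] by (simp add: Y_seq_def)
next
  case (Suc j)
  interpret module_hom smult "(*)" L by (fact L)
  have "L (cheb 3 (Suc j)) + L (cheb 3 j) = L (cheb 1 (Suc j)) - L (cheb 1 j)"
    by (simp only: cheb_3_add flip: add diff)
  then have "L (cheb 3 (Suc j)) = L (cheb 1 (Suc j)) - L (cheb 1 j) - L (cheb 3 j)"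
    by (simp only: algebra_simps)
  then show ?case
    unfolding cheb_1 Y_seq_def Suc diff_divide_distrib[symmetric]
    by (simp only: power_Suc) (simp add: algebra_simps del: P_seq.simps)
qed

lemma functional_psi:
  assumes L: "linear_functional L"
    and cheb_1: "\<And>k. L (cheb 1 k) = Y_seq k"
  shows "L (psi k) = qpoch u k * qpoch u (Suc k) / (1 - u)"
proof -
  have "L (psi k) = (\<Sum>j\<le>k. triple_coeff k j * L (cheb 3 j))"
    unfolding psi_def
    by (rule connection_coeffs.functional_prod_linear[OF connection_coeffs_triple_coeff L])
  also have "\<dots> = (\<Sum>j\<le>k. triple_coeff k j * (P_seq (Suc (Suc j)) - P_seq j + 2 * (-1) ^ j))
      / (u - 1)"
    by (simp only: functional_cheb_3[OF assms] sum_divide_distrib times_divide_eq_right)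
  also have "\<dots> = - (qpoch u k * qpoch u (Suc k)) / - (1 - u)"
    by (simp only: triple_coeff_P_seq_sum minus_diff_eq)
  finally show ?thesis
    by (simp only: minus_divide_divide)
qed

subsection \<open>Continuous dual \<open>q\<close>-Hahn polynomials\<close>

definition hahn_lam :: "nat \<Rightarrow> 'a" where
  "hahn_lam j = (if odd j then (1 - u ^ ((j + 1) div 2))\<^sup>2
    else (1 - u ^ (j div 2)) * (1 - u ^ (j div 2 + 1)))"

definition hahn_coeff :: "nat \<Rightarrow> nat \<Rightarrow> 'a" where
  "hahn_coeff k n = qbinom u k n * u ^ (Suc n choose 2)
     * (qpoch u k * qpoch u (Suc k)) / (qpoch u n * qpoch u (Suc n))"

abbreviation hahn_poly :: "nat \<Rightarrow> 'a poly" where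
  "hahn_poly \<equiv> orth_poly (contraction_diag hahn_lam) (contraction_offdiag hahn_lam)"

abbreviation hahn_op :: "(nat \<Rightarrow> 'a) \<Rightarrow> nat \<Rightarrow> 'a" where
  "hahn_op \<equiv> jacobi_op (contraction_diag hahn_lam) (contraction_offdiag hahn_lam)"

lemma contraction_diag_hahn_lam:
  "contraction_diag hahn_lam n = (1 - u ^ Suc n) * (2 - u ^ n - u ^ Suc n)"
  by (simp add: contraction_diag_def hahn_lam_def algebra_simps power2_eq_square)

lemma contraction_offdiag_hahn_lam:
  "contraction_offdiag hahn_lam (Suc n) = (1 - u ^ Suc n) ^ 3 * (1 - u ^ Suc (Suc n))"
  by (simp add: contraction_offdiag_def hahn_lam_def power3_eq_cube power2_eq_square)

lemma hahn_coeff_0_right: "hahn_coeff k 0 = qpoch u k * qpoch u (Suc k) / (1 - u)"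
  by (simp add: hahn_coeff_def qpoch_def binomial_eq_0)

lemma hahn_coeff_Suc:
  "(1 - u ^ Suc n)\<^sup>2 * (1 - u ^ Suc (Suc n)) * hahn_coeff k (Suc n)
    = u ^ Suc n * ((1 - u ^ Suc n) * qbinom u k (Suc n)) * u ^ (Suc n choose 2)
      * (qpoch u k * qpoch u (Suc k)) / (qpoch u n * qpoch u (Suc n))"
proof -
  define x where "x = 1 - u ^ Suc n"
  define y where "y = 1 - u ^ Suc (Suc n)"
  define D where "D = qpoch u n * qpoch u (Suc n)"
  have "qpoch u (Suc n) * qpoch u (Suc (Suc n)) = D * (x * y)"
    by (simp only: D_def x_def y_def qpoch_Suc mult_ac)
  then have "hahn_coeff k (Suc n) = qbinom u k (Suc n) * (u ^ (Suc n choose 2) * u ^ Suc n)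
      * (qpoch u k * qpoch u (Suc k)) / (D * (x * y))"
    by (simp only: hahn_coeff_def Suc_choose_two[of "Suc n"] power_add)
  moreover have "x \<noteq> 0" "y \<noteq> 0" "D \<noteq> 0"
    using one_minus_power_nonzero qpoch_nonzero by (simp_all add: x_def y_def D_def del: power_Suc)
  ultimately show ?thesis
    unfolding x_def[symmetric] y_def[symmetric] D_def[symmetric]
    by (simp add: power2_eq_square del: power_Suc)
qed

lemma hahn_coeff_Suc_right:
  "(1 - u ^ Suc n)\<^sup>2 * (1 - u ^ Suc (Suc n)) * hahn_coeff k (Suc n)
    = (u ^ Suc n - u ^ Suc k) * hahn_coeff k n"
  unfolding hahn_coeff_Suc mult.assoc[symmetric, of "u ^ Suc n" "1 - u ^ Suc n"] qbinom_Suc_right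
  by (simp add: hahn_coeff_def)

lemma hahn_coeff_Suc_Suc:
  "(1 - u ^ Suc n)\<^sup>2 * (1 - u ^ Suc (Suc n)) * hahn_coeff (Suc k) (Suc n)
    = u ^ Suc n * (1 - u ^ Suc k)\<^sup>2 * (1 - u ^ Suc (Suc k)) * hahn_coeff k n"
  unfolding hahn_coeff_Suc qbinom_absorb
  by (simp add: hahn_coeff_def qpoch_Suc power2_eq_square mult_ac)

lemma hahn_coeff_step_0:
  "hahn_coeff (Suc k) 0 = (1 - u ^ Suc k)\<^sup>2 * hahn_coeff k 0
    + u ^ Suc k * hahn_op (hahn_coeff k) 0"
proof -
  define v where "v = u ^ Suc k"
  have "hahn_coeff (Suc k) 0 = (1 - v) * (1 - u * v) * hahn_coeff k 0"
    by (simp add: hahn_coeff_0_right qpoch_Suc v_def mult_ac)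
  moreover have "contraction_offdiag hahn_lam 1 * hahn_coeff k 1
      = (1 - u) * (u - v) * hahn_coeff k 0"
    using hahn_coeff_Suc_right[of 0 k] contraction_offdiag_hahn_lam[of 0]
    by (simp add: v_def power3_eq_cube power2_eq_square mult.assoc)
  moreover have "contraction_diag hahn_lam 0 = (1 - u)\<^sup>2"
    by (simp add: contraction_diag_hahn_lam power2_eq_square)
  ultimately show ?thesis
    unfolding jacobi_op_0 v_def[symmetric] by algebra
qed

lemma hahn_coeff_step_Suc:
  "hahn_coeff (Suc k) (Suc n) = (1 - u ^ Suc k)\<^sup>2 * hahn_coeff k (Suc n)
    + u ^ Suc k * hahn_op (hahn_coeff k) (Suc n)"
proof -
  define v where "v = u ^ Suc k"
  define x where "x = u ^ Suc n"
  have powers: "u ^ Suc (Suc k) = u * v" "u ^ Suc (Suc n) = u * x"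
    "u ^ Suc (Suc (Suc n)) = u * (u * x)"
    by (simp_all add: v_def x_def)
  have offdiag: "contraction_offdiag hahn_lam (Suc (Suc n)) * hahn_coeff k (Suc (Suc n))
      = (1 - u * x) * (u * x - v) * hahn_coeff k (Suc n)"
    using hahn_coeff_Suc_right[of "Suc n" k]
    unfolding contraction_offdiag_hahn_lam powers v_def[symmetric] x_def[symmetric] by algebra
  have "(1 - x)\<^sup>2 * (1 - u * x) \<noteq> 0"
    using one_minus_power_nonzero[of n] one_minus_power_nonzero[of "Suc n"]
    by (simp add: x_def)
  moreover have "(1 - x)\<^sup>2 * (1 - u * x) * hahn_coeff (Suc k) (Suc n)
      = (1 - x)\<^sup>2 * (1 - u * x) * ((1 - v)\<^sup>2 * hahn_coeff k (Suc n)
        + v * hahn_op (hahn_coeff k) (Suc n))"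
    using hahn_coeff_Suc_right[of n k] hahn_coeff_Suc_Suc[of n k]
    unfolding jacobi_op_Suc offdiag contraction_diag_hahn_lam powers v_def[symmetric] x_def[symmetric]
    by algebra
  ultimately show ?thesis
    unfolding v_def by (simp only: mult_cancel_left simp_thms)
qed

lemma connection_coeffs_hahn_coeff:
  "connection_coeffs (\<lambda>i. (1 - u ^ Suc i)\<^sup>2) (\<lambda>i. u ^ Suc i)
    (contraction_diag hahn_lam) (contraction_offdiag hahn_lam) hahn_coeff"
proof
  fix k n
  show "hahn_coeff 0 n = of_bool (n = 0)"
    using one_minus_u_nonzero by (cases n) (simp_all add: hahn_coeff_def qpoch_def binomial_eq_0)
  show "hahn_coeff (Suc k) n = (1 - u ^ Suc k)\<^sup>2 * hahn_coeff k n
      + u ^ Suc k * hahn_op (hahn_coeff k) n"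
    by (cases n) (simp_all only: hahn_coeff_step_0 hahn_coeff_step_Suc)
qed

lemma functional_hahn_poly:
  assumes "linear_functional L" "\<And>k. L (psi k) = qpoch u k * qpoch u (Suc k) / (1 - u)"
  shows "L (hahn_poly n) = of_bool (n = 0)"
proof (rule connection_coeffs.functional_orth_poly_eq[OF connection_coeffs_hahn_coeff assms(1)])
  show "u ^ Suc i \<noteq> 0" for i
    using u_nonzero by simp
  show "L (\<Prod>i<k. [:(1 - u ^ Suc i)\<^sup>2, u ^ Suc i:])
      = (\<Sum>n\<le>k. hahn_coeff k n * of_bool (n = 0))" for k
    using assms(2)[of k]
    by (simp add: psi_def hahn_coeff_0_right of_bool_def if_distrib[of "times _"] cong: if_cong)
qed

theorem S_fraction_hahn_lam:
  "fps_nth (S_fraction hahn_lam) n = (\<Sum>k\<le>n. of_int (ballot n k) * Y_seq k)"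
proof -
  define L where "L = moment_functional (\<lambda>n. \<Sum>k\<le>n. of_int (ballot n k) * Y_seq k)"
  have L: "linear_functional L"
    unfolding L_def by (rule linear_functional_moment_functional)
  have L_power: "L ([:0, 1:] ^ n) = (\<Sum>k\<le>n. of_int (ballot n k) * Y_seq k)" for n
    unfolding L_def by (rule moment_functional_power)
  have "L (cheb 1 k) = Y_seq k" for k
    using connection_coeffs_ballot L
    by (rule connection_coeffs.functional_orth_poly_eq) (simp_all add: L_power)
  then have "L (hahn_poly n) = of_bool (n = 0)" for n
    using L by (intro functional_hahn_poly functional_psi)
  moreover have "hahn_lam 0 = 0"
    by (simp add: hahn_lam_def)
  ultimately have "L ([:0, 1:] ^ n) = fps_nth (S_fraction hahn_lam) n"
    using L by (intro moments_eq_S_fraction)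
  then show ?thesis
    by (simp only: L_power)
qed

end

section \<open>Specialization to the indeterminate\<close>

lemma to_fract_power: "to_fract (p ^ n) = to_fract p ^ n"
  by (induction n) simp_all

lemma to_fract_of_int: "to_fract (of_int x :: 'a::idom) = of_int x"
proof -
  have "to_fract (of_nat m :: 'a) = of_nat m" for m
    by (induction m) simp_all
  then show ?thesis
    by (cases x rule: int_diff_cases) simp
qed

lemma q_nonzero: "q \<noteq> 0"
  by (simp add: q_def)

lemma q_power_eq_1_iff: "q ^ m = 1 \<longleftrightarrow> m = 0"
proof
  assume "q ^ m = 1"
  then have "to_fract (monom 1 m :: int poly) = to_fract 1"
    by (simp add: q_def monom_altdef to_fract_power)
  then have "monom 1 m = (1 :: int poly)"
    by (simp only: to_fract_eq_iff)
  from arg_cong[OF this, of degree] show "m = 0"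
    by (simp add: degree_monom_eq)
qed simp

interpretation q: non_root_of_unity q
  by standard (simp_all add: q_nonzero q_power_eq_1_iff)

lemma P_int_Suc:
  "P (int k) = monom 1 k * P (int k - 1) + of_int ((-1) ^ k * (2 * int k + 1))"
proof -
  have exponent: "k + ((k choose 2) - (Suc i choose 2)) = (Suc k choose 2) - (Suc i choose 2)"
    if "i < k" for i
  proof -
    have "Suc i choose 2 \<le> k choose 2"
      using that by (intro binomial_right_mono) simp
    then show ?thesis by (simp add: Suc_choose_two[of k])
  qed
  have "P (int k) = (\<Sum>i=0..<Suc k. monom ((-1) ^ i * (2 * int i + 1))
      ((Suc k choose 2) - (Suc i choose 2)))"
    by (simp add: P_def nat_add_distrib del: sum.op_ivl_Suc)
  also have "\<dots> = (\<Sum>i=0..<k. monom 1 k * monom ((-1) ^ i * (2 * int i + 1))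
        ((k choose 2) - (Suc i choose 2)))
      + of_int ((-1) ^ k * (2 * int k + 1))"
    by (simp add: mult_monom exponent of_int_poly monom_0)
  finally show ?thesis
    by (simp add: P_def sum_distrib_left)
qed

lemma to_fract_P: "to_fract (P (int k - 1)) = q.P_seq k"
proof (induction k)
  case 0
  show ?case by (simp add: P_def)
next
  case (Suc k)
  have "to_fract (monom 1 k) = q ^ k"
    by (simp add: q_def monom_altdef to_fract_power)
  then show ?case
    using Suc by (simp add: P_int_Suc[of k] to_fract_of_int del: of_int_mult of_int_add) simp
qed

lemma Y_eq_Y_seq: "Y k = q.Y_seq k"
  using to_fract_P[of k] to_fract_P[of "Suc k"] to_fract_P[of "Suc (Suc k)"]
    to_fract_of_int[of 2, where 'a = "int poly"]
  by (simp add: Y_def q.Y_seq_def algebra_simps del: q.P_seq.simps)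

lemma poly_P_1: "poly (P (int k - 1)) 1 = - ((-1) ^ k) * int k"
proof (induction k)
  case (Suc k)
  then show ?case
    by (simp add: P_int_Suc[of k] poly_monom algebra_simps)
qed (simp add: P_def)

lemma Y_polynomial: "\<exists>p. Y k = to_fract p"
proof -
  define R where "R = P (int k - 1) + 2 * P (int k) + P (int k + 1)"
  have "poly R 1 = 0"
    using poly_P_1[of k] poly_P_1[of "Suc k"] poly_P_1[of "Suc (Suc k)"]
    by (simp add: R_def algebra_simps)
  then obtain p where p: "R = [:-1, 1:] * p"
    by (auto simp: poly_eq_0_iff_dvd)
  have "to_fract [:-1, 1:] = q - 1"
    by (simp add: q_def one_pCons flip: to_fract_1 to_fract_diff)
  then have "Y k = to_fract p"
    using q.one_minus_u_nonzero by (simp add: Y_def R_def[symmetric] p del: mult_pCons_left)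
  then show ?thesis ..
qed

lemma hahn_lam_q: "q.hahn_lam = (\<lambda>j. (1 - q)\<^sup>2 * lam j)"
  using q.one_minus_u_nonzero
  by (auto simp: q.hahn_lam_def lam_def qint_def power_divide power2_eq_square)

theorem theorem9p1:
  shows "(\<forall>k. \<exists>p :: int poly. Y k = to_fract p) \<and>
    (\<forall>n. G2 (n + 1) = 1 / (1 - q) ^ (2 * n) *
      (\<Sum>k = 0..n. of_int (ibinom (2 * n) (int n - int k)
                         - ibinom (2 * n) (int n - int k - 1)) * Y k))"
proof (intro conjI allI)
  show "\<exists>p. Y k = to_fract p" for k
    by (rule Y_polynomial)
next
  fix n
  have "(1 - q) ^ (2 * n) * G2 (n + 1) = fps_nth (S_fraction q.hahn_lam) n"
    by (simp add: hahn_lam_q S_fraction_scale G2_def power_mult)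
  also have "\<dots> = (\<Sum>k\<le>n. of_int (ballot n k) * Y k)"
    by (simp only: q.S_fraction_hahn_lam Y_eq_Y_seq)
  finally show "G2 (n + 1) = 1 / (1 - q) ^ (2 * n) *
      (\<Sum>k = 0..n. of_int (ibinom (2 * n) (int n - int k)
                         - ibinom (2 * n) (int n - int k - 1)) * Y k)"
    using q.one_minus_u_nonzero by (simp add: ballot_def atMost_atLeast0 field_simps)
qed

end
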